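(* Consider an autonomous ODE $\dot{\boldsymbol{x}}=\boldsymbol{f}(\boldsymbol{x})$ in $\mathbb{R}^n$ that possesses a system of $m\le n$ linearly independent affine polynomials $\underline{\boldsymbol{p}}(\boldsymbol{x})=(p_1(\boldsymbol{x}),\dots,p_m(\boldsymbol{x}))^T\in\mathbb{R}^m$ satisfying, along solutions of the ODE, $$\dot{\underline{\boldsymbol{p}}}(\boldsymbol{x})=L\,\underline{\boldsymbol{p}}(\boldsymbol{x}),$$ where $L\in\mathbb{R}^{m\times m}$ is independent of $\boldsymbol{x}$. Then the map $\varphi_h$ of any Runge-Kutta method applied to this ODE satisfies $$\underline{\boldsymbol{p}}(\varphi_h(\boldsymbol{x}))=R(hL)\,\underline{\boldsymbol{p}}(\boldsymbol{x}),$$ where $R(z)$ is the stability function of the method.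
   Context: Here $\dot{\underline{\boldsymbol{p}}}(\boldsymbol{x})$ denotes the vector with components $\boldsymbol{f}(\boldsymbol{x})^T\nabla p_i(\boldsymbol{x})$. An $s$-stage Runge-Kutta method with real coefficients $\mathcal{A}=[a_{ij}]\in\mathbb{R}^{s\times s}$, $\boldsymbol{b}=(b_1,\dots,b_s)^T\in\mathbb{R}^s$ and time step $h$ applied to $\dot{\boldsymbol{x}}=\boldsymbol{f}(\boldsymbol{x})$ defines the map $\varphi_h$ by $$\boldsymbol{g}_i=\boldsymbol{x}+h\sum_{j=1}^s a_{ij}\boldsymbol{f}(\boldsymbol{g}_j)\quad(i=1,\dots,s),\qquad \varphi_h(\boldsymbol{x})=\boldsymbol{x}+h\sum_{j=1}^s b_j\boldsymbol{f}(\boldsymbol{g}_j).$$ Its stability function is the rational function $R(z)=1+z\boldsymbol{b}^T(I-z\mathcal{A})^{-1}\mathbb{1}$, with $\mathbb{1}\in\mathbb{R}^s$ the vector of ones. For a square matrix $Z$, $R(Z)=P(Z)Q(Z)^{-1}$ where $R=P/Q$ with $P,Q$ coprime polynomials. Convention: $\boldsymbol{f}$ is continuously differentiable on an open set $U\subseteq\mathbb{R}^n$; for each $\boldsymbol{x}\in U$, $|h|$ is taken sufficiently small (depending on $\boldsymbol{x}$), and the stages are the solution of the stage equations near $\boldsymbol{x}$ (with $\boldsymbol{g}_i\to\boldsymbol{x}$ as $h\to0$), so that the stages lie in $U$ and $R(hL)$ is defined. *)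

theory Defs
  imports "HOL-Analysis.Analysis" "HOL-Computational_Algebra.Computational_Algebra"
    "HOL-Computational_Algebra.Field_as_Ring"
begin

definition continuously_differentiable_on ::
    "('a::real_normed_vector \<Rightarrow> 'b::real_normed_vector) \<Rightarrow> 'a set \<Rightarrow> bool" where
  "continuously_differentiable_on f U \<longleftrightarrow>
     (\<exists>f'. (\<forall>x\<in>U. (f has_derivative blinfun_apply (f' x)) (at x)) \<and> continuous_on U f')"

definition grad :: "(real^'n \<Rightarrow> real) \<Rightarrow> real^'n \<Rightarrow> real^'n" where
  "grad q x = (THE D. GDERIV q x :> D)"

definition pdot :: "(real^'n \<Rightarrow> real^'n) \<Rightarrow> (real^'n \<Rightarrow> real^'m) \<Rightarrow> real^'n \<Rightarrow> real^'m" where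
  "pdot f p x = (\<chi> i. f x \<bullet> grad (\<lambda>y. p y $ i) x)"

definition affine_polynomial :: "(real^'n \<Rightarrow> real) \<Rightarrow> bool" where
  "affine_polynomial q \<longleftrightarrow> (\<exists>c d. \<forall>x. q x = c \<bullet> x + d)"

text \<open>Linear independence of the components as functions on \<open>real^'n\<close>, hence as polynomials; the
  function space is not an instance of \<^class>\<open>real_vector\<close>.\<close>

definition components_independent :: "(real^'n \<Rightarrow> real^'m) \<Rightarrow> bool" where
  "components_independent p \<longleftrightarrow>
     (\<forall>c::real^'m. (\<forall>x. (\<Sum>i\<in>UNIV. c $ i * p x $ i) = 0) \<longrightarrow> c = 0)"

definition rk_stage_eqs ::
    "(real^'n \<Rightarrow> real^'n) \<Rightarrow> real^'s^'s \<Rightarrow> real \<Rightarrow> real^'n \<Rightarrow> real^'n^'s \<Rightarrow> bool" where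
  "rk_stage_eqs f A h x g \<longleftrightarrow>
     (\<forall>i. g $ i = x + h *\<^sub>R (\<Sum>j\<in>UNIV. A $ i $ j *\<^sub>R f (g $ j)))"

text \<open>The stage equations may have further solutions away from \<open>x\<close>.  The set \<open>V\<close>
  is a neighbourhood of \<open>x\<close> used to select the solution near \<open>x\<close>; the values below are
  meaningful when exactly one solution has all its stages in \<open>V\<close>.\<close>

definition rk_stages ::
    "(real^'n) set \<Rightarrow> (real^'n \<Rightarrow> real^'n) \<Rightarrow> real^'s^'s \<Rightarrow> real \<Rightarrow> real^'n \<Rightarrow> real^'n^'s" where
  "rk_stages V f A h x = (THE g. rk_stage_eqs f A h x g \<and> (\<forall>i. g $ i \<in> V))"

definition rk_map ::
    "(real^'n) set \<Rightarrow> (real^'n \<Rightarrow> real^'n) \<Rightarrow> real^'s^'s \<Rightarrow> real^'s \<Rightarrow> real \<Rightarrow> real^'n \<Rightarrow> real^'n" where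
  "rk_map V f A b h x =
     x + h *\<^sub>R (\<Sum>j\<in>UNIV. b $ j *\<^sub>R f (rk_stages V f A h x $ j))"

text \<open>Rational functions are elements of the field \<^typ>\<open>real poly fract\<close>, in which
  \<open>I - z A\<close> is always invertible, its determinant being \<open>1\<close> at \<open>z = 0\<close>.\<close>

definition ratconst :: "real \<Rightarrow> real poly fract" where
  "ratconst c = to_fract [:c:]"

definition ratvar :: "real poly fract" where
  "ratvar = to_fract [:0, 1:]"

definition stability_function :: "real^'s^'s \<Rightarrow> real^'s \<Rightarrow> real poly fract" where
  "stability_function A b =
     1 + ratvar * (\<Sum>i\<in>UNIV. ratconst (b $ i) *
           (matrix_inv (mat 1 - (\<chi> i j. ratvar * ratconst (A $ i $ j))) *v (\<chi> j. 1)) $ i)"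

text \<open>Powers are iterated matrix products: \<open>^\<close> and \<open>*\<close> on vectors and matrices act
  componentwise.\<close>

definition poly_mat :: "real poly \<Rightarrow> real^'m^'m \<Rightarrow> real^'m^'m" where
  "poly_mat P Z = (\<Sum>k\<le>degree P. coeff P k *\<^sub>R (((**) Z) ^^ k) (mat 1))"

text \<open>\<^const>\<open>quot_of_fract\<close> yields the coprime numerator and (monic) denominator.\<close>

definition rat_mat_defined :: "real poly fract \<Rightarrow> real^'m^'m \<Rightarrow> bool" where
  "rat_mat_defined R Z \<longleftrightarrow> invertible (poly_mat (snd (quot_of_fract R)) Z)"

definition rat_mat :: "real poly fract \<Rightarrow> real^'m^'m \<Rightarrow> real^'m^'m" where
  "rat_mat R Z =
     poly_mat (fst (quot_of_fract R)) Z ** matrix_inv (poly_mat (snd (quot_of_fract R)) Z)"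

end

theory Submission
  imports Defs
begin

text \<open>Since \<open>p\<close> is affine, applying it to the stage equations turns them into the linear system
  \<open>w\<^sub>i = p(x) + Z \<Sum>\<^sub>j a\<^sub>i\<^sub>j w\<^sub>j\<close> with \<open>w\<^sub>i = p(g\<^sub>i)\<close> and \<open>Z = hL\<close>, whose coefficients are
  polynomials in the single matrix \<open>Z\<close>.  Let \<open>D(z) = det (I - zA)\<close>.  Cramer's rule over \<open>\<real>[z]\<close> gives
  polynomials \<open>N\<^sub>k\<close> with \<open>D(Z) w\<^sub>k = N\<^sub>k(Z) p(x)\<close>, and the same polynomials give
  \<open>R = (D + z b\<^sup>TN) / D\<close>.  As \<open>D(0) = 1\<close>, \<open>D(hL)\<close> is invertible for small \<open>h\<close>, and since the reduced
  denominator of \<open>R\<close> divides \<open>D\<close>, it is invertible at \<open>hL\<close> as well.  Existence and local uniqueness of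
  the stages come from Banach's fixed point theorem.\<close>

(* Otherwise the dollar sign is ambiguous between vectors and formal power series. *)
no_notation fps_nth (infixl \<open>$\<close> 75)

section \<open>Adjugates and determinants over commutative rings\<close>

text \<open>\<open>C\<close> holds the cofactors: entry (i,k) is the determinant of the transpose
  with row i replaced by the k-th unit vector. Linearity in row i turns entry (i,j) of
  \<open>C ** M\<close> into the determinant with row i replaced by row j, which has two equal rows
  unless i = j. No division occurs, so the result applies over R[z].\<close>

lemma adjugate_exists:
  fixes M :: "'a::comm_ring_1^'n^'n"
  obtains B where "B ** M = mat (det M)"
proof
  define T where "T = transpose M"
  define C :: "'a^'n^'n" where
    "C = (\<chi> i k. det (\<chi> r. if r = i then axis k 1 else T $ r))"
  have "(\<Sum>k\<in>UNIV. C $ i $ k * T $ j $ k) = (if i = j then det M else 0)" for i j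
  proof -
    have row: "T $ j = (\<Sum>k\<in>UNIV. T $ j $ k *s axis k 1)"
      by (simp add: basis_expansion)
    have "(\<Sum>k\<in>UNIV. C $ i $ k * T $ j $ k)
        = (\<Sum>k\<in>UNIV. det (\<chi> r. if r = i then T $ j $ k *s axis k 1 else T $ r))"
      by (simp add: C_def det_row_mul mult.commute)
    also have "\<dots> = det (\<chi> r. if r = i then \<Sum>k\<in>UNIV. T $ j $ k *s axis k 1 else T $ r)"
      using det_linear_row_sum[of UNIV i "\<lambda>_ k. T $ j $ k *s axis k 1" "\<lambda>r. T $ r"] by simp
    also have "\<dots> = det (\<chi> r. if r = i then T $ j else T $ r)"
      by (simp only: row[symmetric])
    also have "\<dots> = (if i = j then det M else 0)"
    proof (cases "i = j")
      case True
      have "(\<chi> r. if r = i then T $ j else T $ r) = T"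
        using True by (simp add: vec_eq_iff)
      then show ?thesis using True by (simp add: T_def)
    next
      case False
      then show ?thesis
        using det_identical_rows[OF False, of "\<chi> r. if r = i then T $ j else T $ r"]
        by (simp add: row_def)
    qed
    finally show ?thesis .
  qed
  then show "C ** M = mat (det M)"
    by (simp add: vec_eq_iff matrix_matrix_mult_def mat_def T_def transpose_def)
qed

lemma poly_det: "poly (det M) x = det (\<chi> i j. poly (M $ i $ j) x)"
  for M :: "'a::comm_ring_1 poly^'n^'n"
proof -
  have "poly (of_int (sign q)) x = of_int (sign q)" for q :: "'n \<Rightarrow> 'n"
    by (simp add: sign_def)
  then show ?thesis
    by (simp add: det_def poly_sum poly_prod)
qed

section \<open>Polynomials evaluated at a square matrix\<close>

text \<open>Horner's recursion, on which the inductions over polynomials below rest. The zero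
  polynomial is split off because \<open>pCons\<close> raises the degree only of a nonzero
  \<open>P\<close>.\<close>

lemma poly_mat_pCons: "poly_mat (pCons a P) Z = a *\<^sub>R mat 1 + Z ** poly_mat P Z"
proof (cases "P = 0")
  case True
  then show ?thesis by (simp add: poly_mat_def)
next
  case False
  have "Z ** (\<Sum>k\<le>n. F k) = (\<Sum>k\<le>n. Z ** F k)" for n and F :: "nat \<Rightarrow> real^'a^'a"
    by (induction n) (simp_all add: matrix_add_ldistrib)
  moreover have "poly_mat (pCons a P) Z
      = (\<Sum>k\<le>Suc (degree P). coeff (pCons a P) k *\<^sub>R (((**) Z) ^^ k) (mat 1))"
    using False by (simp add: poly_mat_def)
  ultimately show ?thesis
    using False by (simp add: poly_mat_def sum.atMost_Suc_shift matrix_scalar_ac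
        scalar_matrix_assoc[symmetric] del: sum.atMost_Suc)
qed

lemma poly_mat_0 [simp]: "poly_mat 0 Z = 0"
  by (simp add: poly_mat_def)

lemma poly_mat_const: "poly_mat [:a:] Z = a *\<^sub>R mat 1"
  by (simp add: poly_mat_pCons)

lemma poly_mat_1 [simp]: "poly_mat 1 Z = mat 1"
  by (simp add: poly_mat_const one_pCons)

lemma poly_mat_add: "poly_mat (P + Q) Z = poly_mat P Z + poly_mat Q Z"
  by (induction P Q rule: poly_induct2)
    (simp_all add: poly_mat_pCons matrix_add_ldistrib scaleR_left_distrib)

lemma poly_mat_smult: "poly_mat (smult c P) Z = c *\<^sub>R poly_mat P Z"
  by (induction P)
    (simp_all add: poly_mat_pCons matrix_scalar_ac scalar_matrix_assoc[symmetric] scaleR_right_distrib)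

lemma poly_mat_diff: "poly_mat (P - Q) Z = poly_mat P Z - poly_mat Q Z"
  using poly_mat_add[of "P - Q" Q Z] by simp

lemma poly_mat_sum: "poly_mat (sum F S) Z = (\<Sum>i\<in>S. poly_mat (F i) Z)"
  by (induction S rule: infinite_finite_induct) (simp_all add: poly_mat_add)

text \<open>Through this, commutativity of R[z] makes any two polynomials in \<open>Z\<close>
  commute; later proofs exchange matrix factors by \<open>mult.commute\<close> on
  polynomials.\<close>

lemma poly_mat_mult: "poly_mat (P * Q) Z = poly_mat P Z ** poly_mat Q Z"
proof (induction P)
  case (pCons a P)
  have "(X + Y) ** W = X ** W + Y ** W" for X Y W :: "real^'a^'a"
    by (simp add: matrix_matrix_mult_def vec_eq_iff sum.distrib distrib_right)
  with pCons show ?case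
    by (simp add: poly_mat_pCons poly_mat_add poly_mat_smult matrix_mul_assoc
        scalar_matrix_assoc[symmetric])
qed simp

lemma poly_mat_mult_vec: "poly_mat (P * Q) Z *v v = poly_mat P Z *v (poly_mat Q Z *v v)"
  by (simp add: poly_mat_mult matrix_vector_mul_assoc)

lemma matrix_vector_mult_sum_left: "(\<Sum>i\<in>S. M i) *v v = (\<Sum>i\<in>S. M i *v v)"
  for M :: "'i \<Rightarrow> real^'n^'m"
  by (induction S rule: infinite_finite_induct) (simp_all add: matrix_vector_mult_add_rdistrib)

lemma matrix_vector_mult_sum_right: "M *v (\<Sum>i\<in>S. v i) = (\<Sum>i\<in>S. M *v v i)"
  for M :: "real^'n^'m"
  by (induction S rule: infinite_finite_induct) (simp_all add: matrix_vector_right_distrib)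

lemma scaleR_matrix_vector_mult: "(c *\<^sub>R M) *v v = c *\<^sub>R (M *v v)"
  for M :: "real^'n^'m"
  by (simp add: vec_eq_iff matrix_vector_mult_def sum_distrib_left mult.assoc)

text \<open>Horner's recursion gives continuity entry by entry, and a determinant is polynomial in
  the entries.\<close>

lemma continuous_on_det_poly_mat: "continuous_on S (\<lambda>h. det (poly_mat P (h *\<^sub>R L)))"
proof -
  have "continuous_on S (\<lambda>h. poly_mat P (h *\<^sub>R L) $ i $ j)" for i j
  proof (induction P arbitrary: i j)
    case (pCons a P)
    have "continuous_on S (\<lambda>h. a * mat 1 $ i $ j
        + (\<Sum>k\<in>UNIV. h * L $ i $ k * poly_mat P (h *\<^sub>R L) $ k $ j))"
      by (intro continuous_on_add continuous_on_sum continuous_on_mult continuous_on_const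
          continuous_on_id pCons.IH)
    then show ?case
      by (simp add: poly_mat_pCons matrix_matrix_mult_def)
  qed simp
  then show ?thesis
    unfolding det_def
    by (intro continuous_on_sum continuous_on_mult continuous_on_const continuous_on_prod)
qed

section \<open>The matrix I - zA and the linear stage system\<close>

text \<open>I - zA over R[z] rather than over the fraction field: entries, determinant and adjugate
  can then be evaluated at a matrix by \<open>poly_mat\<close>.\<close>

definition stage_poly_matrix :: "real^'s^'s \<Rightarrow> real poly^'s^'s" where
  "stage_poly_matrix A = (\<chi> i j. (if i = j then 1 else 0) - [:0, A $ i $ j:])"

lemma poly_det_stage_poly_matrix: "poly (det (stage_poly_matrix A)) 0 = 1"
proof -
  have "(\<chi> i j. poly (stage_poly_matrix A $ i $ j) 0) = mat 1"
    by (simp add: stage_poly_matrix_def mat_def vec_eq_iff)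
  then show ?thesis by (simp add: poly_det)
qed

lemma det_stage_poly_matrix_neq_0: "det (stage_poly_matrix A) \<noteq> 0"
  using poly_det_stage_poly_matrix[of A] by force

text \<open>The constant term of D is D(0) = 1, so D(hL) is the identity at h = 0; its determinant
  is continuous in h and stays nonzero nearby.\<close>

lemma eventually_invertible_stage_det:
  obtains d where "d > 0"
    "\<And>h. \<bar>h\<bar> < d \<Longrightarrow> invertible (poly_mat (det (stage_poly_matrix A)) (h *\<^sub>R L))"
proof -
  define D where "D = det (stage_poly_matrix A)"
  obtain a E where D: "D = pCons a E" by (rule pCons_cases)
  have "a = 1"
    using poly_det_stage_poly_matrix[of A] D by (simp add: D_def[symmetric])
  then have "det (poly_mat D (0 *\<^sub>R L)) \<noteq> 0"
    by (simp add: D poly_mat_pCons)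
  moreover have "continuous (at 0) (\<lambda>h. det (poly_mat D (h *\<^sub>R L)))"
    using continuous_on_det_poly_mat[of UNIV D L] by (simp add: continuous_on_eq_continuous_at)
  ultimately obtain d where "d > 0" "\<And>h. dist 0 h < d \<Longrightarrow> det (poly_mat D (h *\<^sub>R L)) \<noteq> 0"
    using continuous_at_avoid[of 0 "\<lambda>h. det (poly_mat D (h *\<^sub>R L))" 0] by blast
  then show ?thesis
    using that by (simp add: invertible_det_nz D_def)
qed

text \<open>Over the field of rational functions, the adjugate divided by D inverts I - zA. If y is
  this inverse applied to the vector of ones, then D y has the row sums of \<open>B\<close> as
  entries, so multiplying R = 1 + z b^T y by D leaves only polynomials.\<close>

lemma stability_function_adjugate:
  fixes A :: "real^'s^'s"
  assumes B: "B ** stage_poly_matrix A = mat (det (stage_poly_matrix A))"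
  shows "stability_function A b * to_fract (det (stage_poly_matrix A))
       = to_fract (det (stage_poly_matrix A)
           + [:0, 1:] * (\<Sum>k\<in>UNIV. [:b $ k:] * (\<Sum>i\<in>UNIV. B $ k $ i)))"
proof -
  define M where "M = stage_poly_matrix A"
  define D where "D = det M"
  define MF :: "real poly fract^'s^'s" where
    "MF = mat 1 - (\<chi> i j. ratvar * ratconst (A $ i $ j))"
  define BF :: "real poly fract^'s^'s" where "BF = (\<chi> i j. to_fract (B $ i $ j))"
  have D0: "to_fract D \<noteq> 0"
    using det_stage_poly_matrix_neq_0[of A] by (simp add: D_def M_def)
  have BM: "(\<Sum>k\<in>UNIV. B $ i $ k * M $ k $ j) = (if i = j then D else 0)" for i j
    using B by (auto simp: vec_eq_iff matrix_matrix_mult_def mat_def M_def D_def)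
  have MF: "MF $ i $ j = to_fract (M $ i $ j)" for i j
    by (simp add: MF_def M_def stage_poly_matrix_def mat_def ratvar_def ratconst_def
        flip: to_fract_mult)
  have BMF: "(\<Sum>k\<in>UNIV. BF $ i $ k * MF $ k $ j) = (if i = j then to_fract D else 0)" for i j
    using arg_cong[OF BM[of i j], of to_fract] by (simp add: BF_def MF)
  have "(\<chi> i j. BF $ i $ j / to_fract D) ** MF = mat 1"
    using BMF D0
    by (simp add: vec_eq_iff matrix_matrix_mult_def mat_def flip: sum_divide_distrib)
  then have "invertible MF"
    using invertible_left_inverse by blast
  then have inv: "MF ** matrix_inv MF = mat 1"
    unfolding invertible_def matrix_inv_def by (metis (mono_tags, lifting) someI_ex)
  define y where "y = matrix_inv MF *v (\<chi> j. 1)"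
  have "MF *v y = (\<chi> j. 1)"
    by (simp add: y_def matrix_vector_mul_assoc inv)
  then have "BF *v (MF *v y) = BF *v (\<chi> j. 1)" by simp
  moreover have "BF ** MF = mat (to_fract D)"
    using BMF by (simp add: vec_eq_iff matrix_matrix_mult_def mat_def)
  ultimately have "mat (to_fract D) *v y = BF *v (\<chi> j. 1)"
    by (simp add: matrix_vector_mul_assoc)
  then have y: "to_fract D * y $ k = to_fract (\<Sum>i\<in>UNIV. B $ k $ i)" for k
    by (simp add: vec_eq_iff matrix_vector_mult_def mat_def BF_def if_distrib if_distribR
        cong: if_cong)
  have "stability_function A b * to_fract D
      = to_fract D + ratvar * (\<Sum>k\<in>UNIV. ratconst (b $ k) * (to_fract D * y $ k))"
    by (simp add: stability_function_def y_def MF_def algebra_simps sum_distrib_left)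
  also have "\<dots> = to_fract (D + [:0, 1:] * (\<Sum>k\<in>UNIV. [:b $ k:] * (\<Sum>i\<in>UNIV. B $ k $ i)))"
    unfolding y by (simp only: ratvar_def ratconst_def to_fract_add to_fract_mult to_fract_sum)
  finally show ?thesis by (simp add: D_def M_def)
qed

text \<open>The core of the argument, with the ODE eliminated: \<open>v\<close> stands for p(x),
  \<open>w i\<close> for p(g_i) and \<open>Z\<close> for hL. Invertibility is asked of D(Z), which
  does not depend on \<open>b\<close>, and passes to the reduced denominator.\<close>

lemma linear_stage_solution:
  fixes A :: "real^'s^'s" and Z :: "real^'m^'m" and w :: "'s \<Rightarrow> real^'m"
  assumes inv: "invertible (poly_mat (det (stage_poly_matrix A)) Z)"
    and w: "\<And>i. w i = v + Z *v (\<Sum>j\<in>UNIV. A $ i $ j *\<^sub>R w j)"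
  shows "rat_mat_defined (stability_function A b) Z"
    and "v + Z *v (\<Sum>j\<in>UNIV. b $ j *\<^sub>R w j) = rat_mat (stability_function A b) Z *v v"
proof -
  define M where "M = stage_poly_matrix A"
  define D where "D = det M"
  obtain B where B: "B ** M = mat D"
    unfolding D_def by (rule adjugate_exists)
  define N where "N k = (\<Sum>i\<in>UNIV. B $ k $ i)" for k
  \<comment> \<open>By \<open>stability_function_adjugate\<close>, R = (D + S) / D.\<close>
  define S where "S = [:0, 1:] * (\<Sum>k\<in>UNIV. [:b $ k:] * N k)"
  define P where "P = fst (quot_of_fract (stability_function A b))"
  define Q where "Q = snd (quot_of_fract (stability_function A b))"
  define x where "x = v + Z *v (\<Sum>j\<in>UNIV. b $ j *\<^sub>R w j)"
  have Q0: "Q \<noteq> 0" and coprime: "coprime P Q"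
    by (simp_all add: P_def Q_def coprime_quot_of_fract)
  have "to_fract P = stability_function A b * to_fract Q"
    using Fract_quot_of_fract[of "stability_function A b"] Q0
    by (simp add: Fract_conv_to_fract P_def[symmetric] Q_def[symmetric] field_simps)
  then have "to_fract (P * D) = to_fract (Q * (D + S))"
    using stability_function_adjugate[of B A b] B
    by (simp add: M_def D_def S_def N_def mult_ac del: to_fract_add)
  then have PD: "P * D = Q * (D + S)" by (simp only: to_fract_eq_iff)
  \<comment> \<open>Both P/Q and (D + S)/D represent R. As P/Q is reduced, Q divides D, and
    \<open>E\<close> is the factor lost in the reduction.\<close>
  then have "Q dvd P * D" by simp
  then have "Q dvd D"
    using coprime by (simp add: coprime_dvd_mult_right_iff coprime_commute)
  then obtain E where E: "D = Q * E" ..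
  then have "Q * (P * E) = Q * (D + S)" using PD by (simp add: mult_ac)
  then have DS: "D + S = P * E" using Q0 mult_cancel_left by metis

  \<comment> \<open>Row i of I - zA, evaluated at \<open>Z\<close> and applied to the vectors
    \<open>w j\<close>, restates stage equation i.\<close>
  have stage: "(\<Sum>j\<in>UNIV. poly_mat (M $ i $ j) Z *v w j) = v" for i
  proof -
    have "poly_mat (M $ i $ j) Z *v w j = (if i = j then w j else 0) - A $ i $ j *\<^sub>R (Z *v w j)" for j
      by (simp add: M_def stage_poly_matrix_def poly_mat_diff poly_mat_pCons
          matrix_vector_mult_diff_rdistrib scaleR_matrix_vector_mult matrix_scalar_ac)
    then have "(\<Sum>j\<in>UNIV. poly_mat (M $ i $ j) Z *v w j)
        = w i - (\<Sum>j\<in>UNIV. A $ i $ j *\<^sub>R (Z *v w j))"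
      by (simp add: sum_subtractf)
    also have "(\<Sum>j\<in>UNIV. A $ i $ j *\<^sub>R (Z *v w j)) = Z *v (\<Sum>j\<in>UNIV. A $ i $ j *\<^sub>R w j)"
      by (simp add: matrix_vector_mult_sum_right matrix_vector_mult_scaleR)
    finally show ?thesis using w[of i] by (metis add_diff_cancel_right')
  qed
  \<comment> \<open>Cramer's rule: apply the adjugate of \<open>I - zA\<close>, evaluated at \<open>Z\<close>, to the stage equations.\<close>
  have Dw: "poly_mat D Z *v w k = poly_mat (N k) Z *v v" for k
  proof -
    have "poly_mat (N k) Z *v v
        = (\<Sum>i\<in>UNIV. poly_mat (B $ k $ i) Z *v (\<Sum>j\<in>UNIV. poly_mat (M $ i $ j) Z *v w j))"
      by (simp add: N_def poly_mat_sum matrix_vector_mult_sum_left stage)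
    also have "\<dots> = (\<Sum>i\<in>UNIV. \<Sum>j\<in>UNIV. poly_mat (B $ k $ i * M $ i $ j) Z *v w j)"
      by (simp add: matrix_vector_mult_sum_right poly_mat_mult_vec)
    also have "\<dots> = (\<Sum>j\<in>UNIV. poly_mat (\<Sum>i\<in>UNIV. B $ k $ i * M $ i $ j) Z *v w j)"
      by (subst sum.swap) (simp add: poly_mat_sum matrix_vector_mult_sum_left)
    also have "\<dots> = (\<Sum>j\<in>UNIV. poly_mat ((B ** M) $ k $ j) Z *v w j)"
      by (simp add: matrix_matrix_mult_def)
    also have "\<dots> = (\<Sum>j\<in>UNIV. if k = j then poly_mat D Z *v w j else 0)"
      by (intro sum.cong) (simp_all add: B mat_def)
    also have "\<dots> = poly_mat D Z *v w k" by simp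
    finally show ?thesis ..
  qed
  have Zpoly: "Z *v u = poly_mat [:0, 1:] Z *v u" for u :: "real^'m"
    by (simp add: poly_mat_pCons)
  have const: "poly_mat [:c:] Z *v u = c *\<^sub>R u" for c and u :: "real^'m"
    by (simp add: poly_mat_const scaleR_matrix_vector_mult)
  \<comment> \<open>D(Z) turns each \<open>w k\<close> into N_k(Z) v and commutes with
    \<open>Z\<close>, so that D(Z) x = (D + S)(Z) v.\<close>
  have "poly_mat S Z *v v = Z *v (\<Sum>k\<in>UNIV. b $ k *\<^sub>R (poly_mat D Z *v w k))"
    by (simp add: S_def poly_mat_mult_vec[of "[:0, 1:]"] Zpoly Dw poly_mat_sum
        matrix_vector_mult_sum_left poly_mat_mult_vec const del: mult_pCons_left)
  also have "\<dots> = Z *v (poly_mat D Z *v (\<Sum>k\<in>UNIV. b $ k *\<^sub>R w k))"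
    by (simp add: matrix_vector_mult_sum_right matrix_vector_mult_scaleR)
  also have "\<dots> = poly_mat D Z *v (Z *v (\<Sum>k\<in>UNIV. b $ k *\<^sub>R w k))"
    unfolding Zpoly poly_mat_mult_vec[symmetric] by (simp only: mult.commute)
  finally have "poly_mat D Z *v x = poly_mat (P * E) Z *v v"
    by (simp add: x_def DS[symmetric] poly_mat_add matrix_vector_right_distrib
        matrix_vector_mult_add_rdistrib)
  then have EQ: "poly_mat E Z *v (poly_mat Q Z *v x) = poly_mat E Z *v (poly_mat P Z *v v)"
    by (simp add: E mult.commute flip: poly_mat_mult_vec)
  \<comment> \<open>D = Q E makes det D(Z) a product, so Q(Z) and E(Z) are both invertible and E(Z)
    can be cancelled in \<open>EQ\<close>.\<close>
  have "det (poly_mat Q Z) * det (poly_mat E Z) \<noteq> 0"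
    using inv unfolding M_def[symmetric] D_def[symmetric]
    by (simp add: invertible_det_nz E poly_mat_mult det_mul)
  then have invQ: "invertible (poly_mat Q Z)" and invE: "invertible (poly_mat E Z)"
    by (simp_all add: invertible_det_nz)
  then show "rat_mat_defined (stability_function A b) Z"
    by (simp add: rat_mat_defined_def Q_def)
  have Qx: "poly_mat Q Z *v x = poly_mat P Z *v v"
    using EQ inj_matrix_vector_mult[OF invE] by (simp add: inj_def)
  have Qinv: "poly_mat Q Z ** matrix_inv (poly_mat Q Z) = mat 1"
    using invQ unfolding invertible_def matrix_inv_def by (metis (mono_tags, lifting) someI_ex)
  \<comment> \<open>\<open>rat_mat\<close> has the inverse of Q(Z) on the right, so Q(Z) is first
    moved past P(Z); injectivity of Q(Z) then identifies the vector with \<open>x\<close>.\<close>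
  have "poly_mat Q Z *v (rat_mat (stability_function A b) Z *v v)
      = (poly_mat (Q * P) Z ** matrix_inv (poly_mat Q Z)) *v v"
    by (simp add: rat_mat_def P_def Q_def poly_mat_mult matrix_vector_mul_assoc matrix_mul_assoc)
  also have "\<dots> = poly_mat P Z *v v"
    by (simp add: mult.commute[of Q] poly_mat_mult Qinv flip: matrix_mul_assoc)
  finally show "v + Z *v (\<Sum>j\<in>UNIV. b $ j *\<^sub>R w j) = rat_mat (stability_function A b) Z *v v"
    using Qx inj_matrix_vector_mult[OF invQ] by (simp add: inj_def x_def)
qed

section \<open>Existence and local uniqueness of the stages\<close>

text \<open>Continuity bounds the derivative near \<open>x\<close> by its norm at \<open>x\<close>
  plus 1; the mean value inequality on a convex ball makes this bound a Lipschitz constant.\<close>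

lemma continuously_differentiable_on_imp_locally_lipschitz:
  fixes f :: "'a::real_normed_vector \<Rightarrow> 'b::real_normed_vector"
  assumes "open U" "continuously_differentiable_on f U" "x \<in> U"
  obtains r K where "r > 0" "cball x r \<subseteq> U" "K \<ge> 0"
    "\<And>y z. y \<in> cball x r \<Longrightarrow> z \<in> cball x r \<Longrightarrow> norm (f y - f z) \<le> K * norm (y - z)"
proof -
  obtain f' where f': "\<And>y. y \<in> U \<Longrightarrow> (f has_derivative blinfun_apply (f' y)) (at y)"
    and cont: "continuous_on U f'"
    using assms(2) by (auto simp: continuously_differentiable_on_def)
  have "continuous (at x) f'"
    using cont assms by (simp add: continuous_on_eq_continuous_at)
  then obtain d where d: "d > 0" "\<And>y. dist y x < d \<Longrightarrow> dist (f' y) (f' x) < 1"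
    unfolding continuous_at_eps_delta by (meson zero_less_one)
  obtain e where e: "e > 0" "cball x e \<subseteq> U"
    using assms open_contains_cball by blast
  \<comment> \<open>Half of \<open>d\<close> places the closed ball inside the open ball of radius
    \<open>d\<close>, where \<open>f'\<close> is controlled.\<close>
  define r where "r = min e (d / 2)"
  have sub: "cball x r \<subseteq> U"
    using e by (auto simp: r_def)
  have bound: "norm (f' y) \<le> norm (f' x) + 1" if "y \<in> cball x r" for y
  proof -
    have "dist (f' y) (f' x) < 1"
      using that d by (intro d(2)) (simp add: r_def dist_commute)
    then show ?thesis
      using norm_triangle_ineq2[of "f' y" "f' x"] by (simp add: dist_norm)
  qed
  have "norm (f y - f z) \<le> (norm (f' x) + 1) * norm (y - z)"
    if "y \<in> cball x r" "z \<in> cball x r" for y z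
  proof (rule differentiable_bound[OF convex_cball _ _ that])
    fix u assume u: "u \<in> cball x r"
    show "(f has_derivative blinfun_apply (f' u)) (at u within cball x r)"
      using f' u sub has_derivative_at_withinI by blast
    show "onorm (blinfun_apply (f' u)) \<le> norm (f' x) + 1"
      using bound[OF u] by (simp add: norm_blinfun.rep_eq)
  qed
  moreover have "r > 0" using d e by (simp add: r_def)
  ultimately show ?thesis using that sub by (metis add_nonneg_nonneg norm_ge_zero zero_le_one)
qed

lemma norm_vec_le_sum: "norm x \<le> (\<Sum>i\<in>UNIV. norm (x $ i))"
  by (simp add: norm_vec_def L2_set_le_sum)

text \<open>Banach's theorem for the stage map \<open>G\<close> on \<open>T\<close>, the tuples with
  all stages in the closed ball. \<open>T\<close> is closed, hence complete; for small h,
  \<open>G\<close> sends it into tuples with stages in the open ball, so the fixed point found in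
  \<open>T\<close> is also the only one in the open ball. The bound with \<open>C\<close> later
  gives convergence of the stages to \<open>x\<close>.\<close>

lemma rk_stages_locally_unique:
  fixes f :: "real^'n \<Rightarrow> real^'n" and A :: "real^'s^'s"
  assumes r: "r > 0" and K: "K \<ge> 0"
    and lip: "\<And>y z. y \<in> cball x r \<Longrightarrow> z \<in> cball x r \<Longrightarrow> norm (f y - f z) \<le> K * norm (y - z)"
  obtains d C where "d > 0"
    "\<And>h. \<bar>h\<bar> < d \<Longrightarrow> \<exists>!g. rk_stage_eqs f A h x g \<and> (\<forall>i. g $ i \<in> ball x r)"
    "\<And>h g i. rk_stage_eqs f A h x g \<Longrightarrow> (\<forall>i. g $ i \<in> ball x r) \<Longrightarrow>
      norm (g $ i - x) \<le> \<bar>h\<bar> * C"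
proof -
  define T where "T = {g :: real^'n^'s. \<forall>i. g $ i \<in> cball x r}"
  define G where
    "G h g = (\<chi> i. x + h *\<^sub>R (\<Sum>j\<in>UNIV. A $ i $ j *\<^sub>R f (g $ j)))" for h and g :: "real^'n^'s"
  \<comment> \<open>\<open>a\<close> serves twice: it dominates each absolute row sum in
    \<open>near\<close>, and it is the total arising in \<open>contr\<close>, where the norm of a
    tuple is bounded by the sum of the norms of its stages.\<close>
  define a where "a = (\<Sum>i\<in>UNIV. \<Sum>j\<in>UNIV. \<bar>A $ i $ j\<bar>)"
  define m where "m = norm (f x) + K * r"
  \<comment> \<open>The first bound makes the contraction factor |h| a K less than 1, the second
    keeps |h| a m below \<open>r\<close>; adding 1 avoids zero denominators.\<close>
  define d where "d = min (1 / (2 * (a * K + 1))) (r / (a * m + 1))"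
  have a: "a \<ge> 0" and m: "m \<ge> 0"
    using r K by (simp_all add: a_def m_def sum_nonneg)
  have aK: "a * K \<ge> 0" and am: "a * m \<ge> 0"
    using a K m by simp_all
  have row: "(\<Sum>j\<in>UNIV. \<bar>A $ i $ j\<bar>) \<le> a" for i
    unfolding a_def by (rule member_le_sum) (simp_all add: sum_nonneg)
  have eq: "rk_stage_eqs f A h x g \<longleftrightarrow> G h g = g" for h g
    by (auto simp: rk_stage_eqs_def G_def vec_eq_iff)
  have fm: "norm (f y) \<le> m" if "y \<in> cball x r" for y
  proof -
    have "norm (f y - f x) \<le> K * norm (y - x)"
      using lip[OF that, of x] r by simp
    also have "\<dots> \<le> K * r"
      using that K by (intro mult_left_mono) (simp_all add: dist_norm norm_minus_commute)
    finally show ?thesis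
      using norm_triangle_ineq2[of "f y" "f x"] by (simp add: m_def)
  qed
  have near: "norm (G h g $ i - x) \<le> \<bar>h\<bar> * (a * m)" if "g \<in> T" for h g i
  proof -
    have "norm (\<Sum>j\<in>UNIV. A $ i $ j *\<^sub>R f (g $ j)) \<le> (\<Sum>j\<in>UNIV. \<bar>A $ i $ j\<bar> * m)"
      using that by (intro sum_norm_le) (simp add: T_def fm mult_left_mono)
    also have "\<dots> \<le> a * m"
      using row[of i] m by (simp add: mult_right_mono flip: sum_distrib_right)
    finally show ?thesis
      by (simp add: G_def mult_left_mono)
  qed
  have contr: "norm (G h g - G h g') \<le> (\<bar>h\<bar> * (a * K)) * norm (g - g')"
    if "g \<in> T" "g' \<in> T" for h g g'
  proof -
    have "norm (G h g - G h g') \<le> (\<Sum>i\<in>UNIV. norm ((G h g - G h g') $ i))"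
      by (rule norm_vec_le_sum)
    also have "\<dots> \<le> (\<Sum>i\<in>UNIV. \<bar>h\<bar> * (\<Sum>j\<in>UNIV. \<bar>A $ i $ j\<bar> * (K * norm (g - g'))))"
    proof (rule sum_mono)
      fix i
      have "norm (f (g $ j) - f (g' $ j)) \<le> K * norm (g - g')" for j
      proof -
        have "norm (f (g $ j) - f (g' $ j)) \<le> K * norm ((g - g') $ j)"
          using that lip by (simp add: T_def)
        also have "\<dots> \<le> K * norm (g - g')"
          using K by (intro mult_left_mono Finite_Cartesian_Product.norm_nth_le)
        finally show ?thesis .
      qed
      then have "norm (\<Sum>j\<in>UNIV. A $ i $ j *\<^sub>R (f (g $ j) - f (g' $ j)))
          \<le> (\<Sum>j\<in>UNIV. \<bar>A $ i $ j\<bar> * (K * norm (g - g')))"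
        by (intro sum_norm_le) (simp add: mult_left_mono)
      moreover have "(G h g - G h g') $ i = h *\<^sub>R (\<Sum>j\<in>UNIV. A $ i $ j *\<^sub>R (f (g $ j) - f (g' $ j)))"
        by (simp add: G_def scaleR_right_diff_distrib sum_subtractf)
      ultimately show "norm ((G h g - G h g') $ i)
          \<le> \<bar>h\<bar> * (\<Sum>j\<in>UNIV. \<bar>A $ i $ j\<bar> * (K * norm (g - g')))"
        by (simp add: mult_left_mono)
    qed
    also have "\<dots> = (\<bar>h\<bar> * (a * K)) * norm (g - g')"
      by (simp add: a_def sum_distrib_right sum_distrib_left mult_ac)
    finally show ?thesis .
  qed
  have "closed T"
  proof -
    have "T = (\<Inter>i. (\<lambda>g. g $ i) -` cball x r)" by (auto simp: T_def)
    then show ?thesis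
      by (auto intro!: closed_INT continuous_closed_vimage continuous_intros)
  qed
  then have "complete T" by (simp add: complete_eq_closed)
  have ball_T: "g \<in> T" if "\<forall>i. g $ i \<in> ball x r" for g
    using that by (simp add: T_def less_imp_le)
  show ?thesis
  proof (rule that[of d "a * m"])
    show "d > 0" using aK am r by (simp add: d_def)
    fix h :: real assume h: "\<bar>h\<bar> < d"
    have "\<bar>h\<bar> * (2 * (a * K + 1)) < 1"
      using h aK by (simp add: d_def pos_less_divide_eq)
    then have c: "\<bar>h\<bar> * (a * K) < 1"
      using abs_ge_zero[of h] aK by (simp add: algebra_simps)
    have "\<bar>h\<bar> * (a * m + 1) < r"
      using h am by (simp add: d_def pos_less_divide_eq)
    then have hr: "\<bar>h\<bar> * (a * m) < r"
      using abs_ge_zero[of h] unfolding distrib_left mult_1_right by linarith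
    have into: "G h g $ i \<in> ball x r" if "g \<in> T" for g i
      using near[OF that, of h i] hr by (simp add: dist_norm norm_minus_commute)
    have "\<exists>!g\<in>T. G h g = g"
    proof (rule Banach_fix[OF \<open>complete T\<close> _ _ c])
      have "(\<chi> i. x) \<in> T" using r by (simp add: T_def)
      then show "T \<noteq> {}" by blast
      show "0 \<le> \<bar>h\<bar> * (a * K)" using aK by simp
      show "G h ` T \<subseteq> T" using into ball_T by blast
      show "dist (G h g) (G h g') \<le> \<bar>h\<bar> * (a * K) * dist g g'" if "g \<in> T" "g' \<in> T" for g g'
        using contr[OF that] by (simp add: dist_norm)
    qed
    then show "\<exists>!g. rk_stage_eqs f A h x g \<and> (\<forall>i. g $ i \<in> ball x r)"
      unfolding eq using into ball_T by metis
  next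
    fix h g i assume "rk_stage_eqs f A h x g" "\<forall>i. g $ i \<in> ball x r"
    then show "norm (g $ i - x) \<le> \<bar>h\<bar> * (a * m)"
      using near[OF ball_T, of g h i] by (simp add: eq)
  qed
qed

section \<open>Affine polynomials along the ODE\<close>

lemma grad_affine: "grad (\<lambda>y. c \<bullet> y + d) x = c"
proof -
  have D: "((\<lambda>y. c \<bullet> y + d) has_derivative (\<lambda>u. u \<bullet> c)) (at x)"
    by (auto intro!: derivative_eq_intros simp: inner_commute)
  show ?thesis
    unfolding grad_def
  proof (rule the_equality)
    show "GDERIV (\<lambda>y. c \<bullet> y + d) x :> c" using D by (simp add: gderiv_def)
    fix e assume "GDERIV (\<lambda>y. c \<bullet> y + d) x :> e"
    then have "(\<lambda>u. u \<bullet> e) = (\<lambda>u. u \<bullet> c)"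
      using D has_derivative_unique unfolding gderiv_def by blast
    then show "e = c" by (metis inner_commute vector_eq_rdot)
  qed
qed

text \<open>The rows of \<open>C\<close> are the gradients of the components, constant because these
  are affine. So one matrix describes both the increments of p and \<open>pdot\<close>, which lets
  the Runge-Kutta increments be rewritten through L.\<close>

lemma affine_polynomial_pdot:
  fixes p :: "real^'n \<Rightarrow> real^'m"
  assumes "\<forall>i. affine_polynomial (\<lambda>x. p x $ i)"
  obtains C :: "real^'n^'m" where "\<And>y u. p (y + u) = p y + C *v u" "\<And>f y. pdot f p y = C *v f y"
proof -
  obtain c d where p: "\<And>i x. p x $ i = c i \<bullet> x + d i"
    using assms unfolding affine_polynomial_def by metis
  have Cv: "(\<chi> i. c i) *v u = (\<chi> i. c i \<bullet> u)" for u
    by (simp add: matrix_mult_dot)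
  show ?thesis
  proof
    show "p (y + u) = p y + (\<chi> i. c i) *v u" for y u
      by (simp add: Cv vec_eq_iff p inner_right_distrib)
    show "pdot f p y = (\<chi> i. c i) *v f y" for f y
      by (simp add: Cv pdot_def p grad_affine inner_commute[of "f y"])
  qed
qed

text \<open>The ball around x selects the branch of stages near x; that this selection is
  legitimate, with exactly one solution there and convergence to x as h tends to 0, is part of the
  conclusion.\<close>

theorem corollary4:
  fixes f :: "real^'n \<Rightarrow> real^'n"
    and U :: "(real^'n) set"
    and p :: "real^'n \<Rightarrow> real^'m"
    and L :: "real^'m^'m"
    and A :: "real^'s^'s"
    and b :: "real^'s"
  assumes "open U"
    and "continuously_differentiable_on f U"
    and "CARD('m) \<le> CARD('n)"
    and "\<forall>i. affine_polynomial (\<lambda>x. p x $ i)"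
    and "components_independent p"
    and "\<forall>x\<in>U. pdot f p x = L *v p x"
  shows "\<forall>x\<in>U. \<exists>r>0. \<exists>\<delta>>0. ball x r \<subseteq> U \<and>
           (\<forall>h. \<bar>h\<bar> < \<delta> \<longrightarrow>
              (\<exists>!g. rk_stage_eqs f A h x g \<and> (\<forall>i. g $ i \<in> ball x r)) \<and>
              rat_mat_defined (stability_function A b) (h *\<^sub>R L) \<and>
              p (rk_map (ball x r) f A b h x)
                = rat_mat (stability_function A b) (h *\<^sub>R L) *v p x) \<and>
           ((\<lambda>h. rk_stages (ball x r) f A h x) \<longlongrightarrow> (\<chi> i. x)) (at 0)"
proof
  fix x assume "x \<in> U"
  obtain r K where r: "r > 0" and sub: "cball x r \<subseteq> U" and K: "K \<ge> 0"
    and lip: "\<And>y z. y \<in> cball x r \<Longrightarrow> z \<in> cball x r \<Longrightarrow> norm (f y - f z) \<le> K * norm (y - z)"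
    using continuously_differentiable_on_imp_locally_lipschitz[OF assms(1,2) \<open>x \<in> U\<close>] by blast
  obtain d1 c where d1: "d1 > 0"
    and unique: "\<And>h. \<bar>h\<bar> < d1 \<Longrightarrow> \<exists>!g. rk_stage_eqs f A h x g \<and> (\<forall>i. g $ i \<in> ball x r)"
    and near: "\<And>h g i. rk_stage_eqs f A h x g \<Longrightarrow> (\<forall>i. g $ i \<in> ball x r) \<Longrightarrow>
      norm (g $ i - x) \<le> \<bar>h\<bar> * c"
    using rk_stages_locally_unique[OF r K lip, where A = A] by blast
  obtain d2 where d2: "d2 > 0"
    and inv: "\<And>h. \<bar>h\<bar> < d2 \<Longrightarrow> invertible (poly_mat (det (stage_poly_matrix A)) (h *\<^sub>R L))"
    using eventually_invertible_stage_det by blast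
  obtain C :: "real^'n^'m" where affine: "\<And>y u. p (y + u) = p y + C *v u"
    and pdot: "\<And>f y. pdot f p y = C *v f y"
    using affine_polynomial_pdot[OF assms(4)] by blast
  define g where "g h = rk_stages (ball x r) f A h x" for h
  have g: "rk_stage_eqs f A h x (g h)" "\<forall>i. g h $ i \<in> ball x r" if "\<bar>h\<bar> < d1" for h
    using theI'[OF unique[OF that]] by (simp_all add: g_def rk_stages_def)
  \<comment> \<open>Arbitrary weights \<open>k\<close> cover both uses: a row of \<open>A\<close>
    gives a stage equation for the values p(g_i), and \<open>b\<close> gives the update.\<close>
  have p_step: "p (x + h *\<^sub>R (\<Sum>j\<in>UNIV. k j *\<^sub>R f (g h $ j)))
      = p x + (h *\<^sub>R L) *v (\<Sum>j\<in>UNIV. k j *\<^sub>R p (g h $ j))" if "\<bar>h\<bar> < d1" for h and k :: "'s \<Rightarrow> real"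
  proof -
    \<comment> \<open>All stages lie in the ball, hence in \<open>U\<close>, where the hypothesis on
      \<open>pdot\<close> holds.\<close>
    have "C *v f (g h $ j) = L *v p (g h $ j)" for j
      using g(2)[OF that] sub assms(6) pdot by (metis ball_subset_cball subsetD)
    then show ?thesis
      by (simp add: affine matrix_vector_mult_sum_right matrix_vector_mult_scaleR
          scaleR_matrix_vector_mult scaleR_sum_right mult.commute)
  qed
  have R: "rat_mat_defined (stability_function A b) (h *\<^sub>R L)"
    "p (rk_map (ball x r) f A b h x) = rat_mat (stability_function A b) (h *\<^sub>R L) *v p x"
    if h: "\<bar>h\<bar> < d1" "\<bar>h\<bar> < d2" for h
  proof -
    have w: "p (g h $ i) = p x + (h *\<^sub>R L) *v (\<Sum>j\<in>UNIV. A $ i $ j *\<^sub>R p (g h $ j))" for i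
      using p_step[OF h(1), of "\<lambda>j. A $ i $ j"] g(1)[OF h(1)] by (metis rk_stage_eqs_def)
    show "rat_mat_defined (stability_function A b) (h *\<^sub>R L)"
      by (rule linear_stage_solution(1)[OF inv[OF h(2)] w])
    show "p (rk_map (ball x r) f A b h x) = rat_mat (stability_function A b) (h *\<^sub>R L) *v p x"
      using linear_stage_solution(2)[OF inv[OF h(2)] w, of b] p_step[OF h(1), of "\<lambda>j. b $ j"]
      by (simp add: rk_map_def g_def)
  qed
  have "(g \<longlongrightarrow> (\<chi> i. x)) (at 0)"
  proof (rule vec_tendstoI)
    fix i
    have "\<forall>\<^sub>F h in at 0. norm (g h $ i - x) \<le> \<bar>h\<bar> * c"
      unfolding eventually_at using d1 g near by (intro exI[of _ d1]) auto
    moreover have "((\<lambda>h::real. \<bar>h\<bar> * c) \<longlongrightarrow> 0) (at 0)"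
      by (auto intro!: tendsto_eq_intros)
    ultimately have "((\<lambda>h. g h $ i - x) \<longlongrightarrow> 0) (at 0)"
      by (rule Lim_null_comparison)
    then show "((\<lambda>h. g h $ i) \<longlongrightarrow> (\<chi> i. x) $ i) (at 0)"
      by (simp add: Lim_null[of _ x])
  qed
  moreover have "ball x r \<subseteq> U" using sub ball_subset_cball by blast
  ultimately show "\<exists>r>0. \<exists>\<delta>>0. ball x r \<subseteq> U \<and>
      (\<forall>h. \<bar>h\<bar> < \<delta> \<longrightarrow>
         (\<exists>!g. rk_stage_eqs f A h x g \<and> (\<forall>i. g $ i \<in> ball x r)) \<and>
         rat_mat_defined (stability_function A b) (h *\<^sub>R L) \<and>
         p (rk_map (ball x r) f A b h x) = rat_mat (stability_function A b) (h *\<^sub>R L) *v p x) \<and>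
      ((\<lambda>h. rk_stages (ball x r) f A h x) \<longlongrightarrow> (\<chi> i. x)) (at 0)"
    using r d1 d2 unique R unfolding g_def
    by (intro exI[of _ r] conjI exI[of _ "min d1 d2"]) auto
qed

end
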